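(* Let $G_1$ be a connected $\delta_1$-regular graph on $n$ vertices and $G_2$ a connected $\delta_2$-regular graph on $\delta_1$ vertices, and let $G_1\circledR G_2$ be their replacement product (with respect to an arbitrary edge labelling of $G_1$). Write $\lambda_i=\lambda(G_i)$ and $\kappa_i=\kappa(G_i)$ for $i=1,2$. Then $$\min\{\lambda_1,\lambda_2\}\leqslant \lambda(G_1\circledR G_2)\leqslant \min\{\lambda_1,\delta_2+1\}.$$ Furthermore, if $\kappa_1\geqslant 2$, then $$\min\{\lambda_1,\lambda_2+1\}\leqslant \lambda(G_1\circledR G_2).$$
   Context: All graphs are finite, simple, undirected, with nonempty vertex set. $\kappa(G)$ and $\lambda(G)$ denote the (vertex-)connectivity and edge-connectivity of $G$ (with the usual conventions $\kappa(K_m)=m-1$, $\lambda(K_1)=0$). Replacement product: let $G_1$ be a $\delta_1$-regular graph on $n$ vertices and $G_2$ a $\delta_2$-regular graph on $\delta_1$ vertices. For every vertex $x\in V(G_1)$, label the $\delta_1$ edges incident with $x$ bijectively by the vertices of $G_2$; $e_x^i$ denotes the edge at $x$ with label $i\in V(G_2)$ (an edge $xy$ may receive different labels at $x$ and at $y$). The replacement product $G_1\circledR G_2$ has vertex-set $V(G_1)\times V(G_2)$; two distinct vertices $(x,i)$ and $(y,j)$ are adjacent if and only if either $x=y$ and $ij\in E(G_2)$, or $xy\in E(G_1)$ and $e_x^i=xy=e_y^j$. *)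

theory Defs
  imports "Graph_Theory.Graph_Theory"
begin

text \<open>
  A finite simple graph is a \<open>pair_graph\<close>, that is, a finite loop-free symmetric digraph
  without parallel arcs. An undirected edge is the two-element set of its ends and
  corresponds to a pair of opposite arcs.
\<close>

definition uedges :: "'a pair_pre_digraph \<Rightarrow> 'a set set" where
  "uedges G = {{u, v} | u v. (u, v) \<in> parcs G}"

definition uedges_at :: "'a pair_pre_digraph \<Rightarrow> 'a \<Rightarrow> 'a set set" where
  "uedges_at G x = {e \<in> uedges G. x \<in> e}"

definition regular_graph :: "nat \<Rightarrow> 'a pair_pre_digraph \<Rightarrow> bool" where
  "regular_graph d G \<longleftrightarrow>
     pair_graph G \<and> pverts G \<noteq> {} \<and> (\<forall>x\<in>pverts G. card (uedges_at G x) = d)"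

definition delete_uedges :: "'a pair_pre_digraph \<Rightarrow> 'a set set \<Rightarrow> 'a pair_pre_digraph" where
  "delete_uedges G F = G\<lparr>parcs := {(u, v) \<in> parcs G. {u, v} \<notin> F}\<rparr>"

text \<open>
  In both definitions the \<open>LEAST\<close> ranges over a nonempty set of numbers whenever \<open>G\<close> is a
  \<open>pair_graph\<close> with a vertex: deleting all edges disconnects a graph with at least two vertices,
  and deleting all vertices other than two non-adjacent ones disconnects a non-complete graph.
  The complete graphs (including the one with a single vertex) follow the usual convention.
\<close>

definition edge_connectivity :: "'a pair_pre_digraph \<Rightarrow> nat" where
  "edge_connectivity G =
     (if card (pverts G) = 1 then 0
      else LEAST k. \<exists>F \<subseteq> uedges G. card F = k \<and>
             \<not> Digraph_Component.connected (with_proj (delete_uedges G F)))"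

definition vertex_connectivity :: "'a pair_pre_digraph \<Rightarrow> nat" where
  "vertex_connectivity G =
     (if complete_digraph (card (pverts G)) (with_proj G) then card (pverts G) - 1
      else LEAST k. \<exists>S \<subset> pverts G. card S = k \<and>
             \<not> Digraph_Component.connected (induce_subgraph (with_proj G) (pverts G - S)))"

text \<open>\<open>e x i\<close> is the edge at \<open>x\<close> that carries the label \<open>i\<close>.\<close>

definition edge_labelling ::
    "'a pair_pre_digraph \<Rightarrow> 'b pair_pre_digraph \<Rightarrow> ('a \<Rightarrow> 'b \<Rightarrow> 'a set) \<Rightarrow> bool" where
  "edge_labelling G H e \<longleftrightarrow>
     (\<forall>x\<in>pverts G. bij_betw (e x) (pverts H) (uedges_at G x))"

definition replacement_product ::
    "'a pair_pre_digraph \<Rightarrow> 'b pair_pre_digraph \<Rightarrow> ('a \<Rightarrow> 'b \<Rightarrow> 'a set) \<Rightarrow>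
     ('a \<times> 'b) pair_pre_digraph" where
  "replacement_product G H e =
     \<lparr> pverts = pverts G \<times> pverts H,
       parcs = {((x, i), (y, j)) | x i y j.
                  (x, i) \<in> pverts G \<times> pverts H \<and> (y, j) \<in> pverts G \<times> pverts H \<and>
                  (x, i) \<noteq> (y, j) \<and>
                  (x = y \<and> (i, j) \<in> parcs H \<or>
                   (x, y) \<in> parcs G \<and> e x i = {x, y} \<and> e y j = {x, y})} \<rparr>"

end

theory Submission
  imports Defs
begin

text \<open>
  The edges of the replacement product \<open>P\<close> of \<open>G\<close> and \<open>H\<close> fall into two classes: those inside one of
  the disjoint copies \<open>{x} \<times> H\<close>, and the matching edges, which correspond bijectively to the edges
  of \<open>G\<close>. Contracting every copy turns \<open>P\<close> into \<open>G\<close>.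

  Upper bounds: the matching edges over an edge cut of \<open>G\<close> form an edge cut of \<open>P\<close>, since a path of
  \<open>P\<close> avoiding them contracts to a path of \<open>G\<close> avoiding the cut (\<open>lift_edge_cut\<close>). A vertex \<open>(x, i)\<close>
  meets the copies of the edges at \<open>i\<close> and a single matching edge, so deleting its edges isolates it
  (\<open>card_uedges_at_product\<close>).

  Lower bounds: let \<open>F\<close> be a set of edges of \<open>P\<close> with fewer than \<open>\<lambda>(G)\<close> elements. If \<open>F\<close> has fewer than
  \<open>\<lambda>(H)\<close> edges in each copy, then every copy stays connected, and so do the copies among each other,
  because \<open>G\<close> minus the edges whose matching edge lies in \<open>F\<close> is connected
  (\<open>connected_if_copies_connected\<close>). This gives the first bound. If only \<open>card F \<le> \<lambda>(H)\<close> is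
  known, this argument fails only when all of \<open>F\<close> lies in a single copy \<open>{x} \<times> H\<close>. Then the other
  copies and all matching edges are intact. For \<open>\<kappa>(G) \<ge> 2\<close> the graph \<open>G - x\<close> is connected, hence so is
  \<open>P\<close> without the copy of \<open>x\<close>, and each vertex of that copy is attached to this part by its own
  matching edge (\<open>connected_if_cut_in_one_copy\<close>).
\<close>

section \<open>Edge cuts and connectivity\<close>

lemma (in sym_digraph) connected_iff_rtrancl:
  "connected G \<longleftrightarrow>
     verts G \<noteq> {} \<and> (\<forall>u\<in>verts G. \<forall>v\<in>verts G. (u, v) \<in> (arcs_ends G)\<^sup>*)"
proof -
  have "u \<rightarrow>\<^sup>*\<^bsub>with_proj (mk_symmetric G)\<^esub> v \<longleftrightarrow> (u, v) \<in> (arcs_ends G)\<^sup>*" if "u \<in> verts G" for u v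
    using reachable_mk_symmetric_eq[OF sym_arcs, of u v] reachable_conv'[OF that, of v] by blast
  then show ?thesis
    unfolding connected_def strongly_connected_def by auto
qed

lemma pair_graph_connected_iff:
  assumes "pair_graph G"
  shows "Digraph_Component.connected (with_proj G) \<longleftrightarrow>
     pverts G \<noteq> {} \<and> (\<forall>u\<in>pverts G. \<forall>v\<in>pverts G. (u, v) \<in> (parcs G)\<^sup>*)"
proof -
  interpret pair_graph G by fact
  show ?thesis using connected_iff_rtrancl by simp
qed

lemma pverts_delete_uedges [simp]: "pverts (delete_uedges G F) = pverts G"
  by (simp add: delete_uedges_def)

lemma parcs_delete_uedges:
  "(u, v) \<in> parcs (delete_uedges G F) \<longleftrightarrow> (u, v) \<in> parcs G \<and> {u, v} \<notin> F"
  by (simp add: delete_uedges_def)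

lemma pair_graphI:
  assumes "finite (pverts G)"
    and "\<And>u v. (u, v) \<in> parcs G \<Longrightarrow> u \<in> pverts G \<and> v \<in> pverts G \<and> u \<noteq> v \<and> (v, u) \<in> parcs G"
  shows "pair_graph G"
proof -
  have "parcs G \<subseteq> pverts G \<times> pverts G"
    using assms(2) by auto
  with assms(1) have "finite (parcs G)"
    by (meson finite_SigmaI finite_subset)
  with assms show ?thesis
    by unfold_locales (force simp: symmetric_def sym_def)+
qed

lemma pair_graphD:
  assumes "pair_graph G" "(u, v) \<in> parcs G"
  shows "u \<in> pverts G" "v \<in> pverts G" "u \<noteq> v" "(v, u) \<in> parcs G"
proof -
  interpret pair_graph G by fact
  show "u \<in> pverts G" "v \<in> pverts G" "u \<noteq> v" "(v, u) \<in> parcs G"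
    using assms(2) in_arcsD1 in_arcsD2 no_loops' arcs_symmetric by blast+
qed

lemma pair_graph_delete_uedges:
  assumes "pair_graph G"
  shows "pair_graph (delete_uedges G F)"
proof -
  interpret pair_graph G by fact
  show ?thesis
    using pair_graphD[OF assms] pair_finite_verts
    by (intro pair_graphI) (auto simp: parcs_delete_uedges insert_commute)
qed

lemmas connected_delete_uedges_iff =
  pair_graph_connected_iff[OF pair_graph_delete_uedges, unfolded pverts_delete_uedges]

lemma finite_uedges:
  assumes "pair_graph G"
  shows "finite (uedges G)"
proof -
  interpret pair_graph G by fact
  have "uedges G = (\<lambda>(u, v). {u, v}) ` parcs G"
    by (auto simp: uedges_def)
  with pair_finite_arcs show ?thesis by simp
qed

lemma uedges_iff:
  assumes "pair_graph G"
  shows "{u, v} \<in> uedges G \<longleftrightarrow> (u, v) \<in> parcs G"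
  using pair_graphD(4)[OF assms] by (auto simp: uedges_def doubleton_eq_iff)

lemma uedges_at_obtain_arc:
  assumes "pair_graph G" "f \<in> uedges_at G x"
  obtains y where "(x, y) \<in> parcs G" "f = {x, y}"
proof -
  obtain u v where "f = {u, v}" "(u, v) \<in> parcs G" "x = u \<or> x = v"
    using assms(2) by (auto simp: uedges_at_def uedges_def)
  with that pair_graphD(4)[OF assms(1)] show ?thesis
    by (metis insert_commute)
qed

lemma edge_connectivity_le_card_cut:
  assumes "card (pverts G) \<noteq> 1" "F \<subseteq> uedges G"
    and "\<not> Digraph_Component.connected (with_proj (delete_uedges G F))"
  shows "edge_connectivity G \<le> card F"
proof -
  have "(LEAST k. \<exists>F \<subseteq> uedges G. card F = k \<and>
          \<not> Digraph_Component.connected (with_proj (delete_uedges G F))) \<le> card F"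
    using assms(2,3) by (intro Least_le) blast
  with assms(1) show ?thesis
    by (simp add: edge_connectivity_def)
qed

lemma connected_delete_few_uedges:
  assumes "F \<subseteq> uedges G" "card F < edge_connectivity G"
  shows "Digraph_Component.connected (with_proj (delete_uedges G F))"
proof -
  have "card F < (LEAST k. \<exists>F \<subseteq> uedges G. card F = k \<and>
          \<not> Digraph_Component.connected (with_proj (delete_uedges G F)))"
    using assms(2) by (simp add: edge_connectivity_def split: if_splits)
  from not_less_Least[OF this] assms(1) show ?thesis by blast
qed

lemma not_connected_delete_uedges_at:
  assumes "pair_graph G" "u \<in> pverts G" "v \<in> pverts G" "u \<noteq> v"
  shows "\<not> Digraph_Component.connected (with_proj (delete_uedges G (uedges_at G u)))"
proof -
  have "(u, w) \<notin> parcs (delete_uedges G (uedges_at G u))" for w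
    by (simp add: parcs_delete_uedges uedges_at_def uedges_iff[OF assms(1)])
  then have "(u, v) \<notin> (parcs (delete_uedges G (uedges_at G u)))\<^sup>*"
    using assms(4) by (metis converse_rtranclE)
  with assms show ?thesis
    by (auto simp: connected_delete_uedges_iff)
qed

lemma obtain_other_vertex:
  assumes "finite V" "2 \<le> card V"
  obtains v where "v \<in> V" "v \<noteq> u"
proof -
  have "\<not> V \<subseteq> {u}"
    using assms card_mono[of "{u}" V] by auto
  with that show ?thesis by blast
qed

lemma pair_graph_finite_pverts: "pair_graph G \<Longrightarrow> finite (pverts G)"
  by (simp add: pair_graph_def pair_digraph_def pair_fin_digraph.pair_finite_verts)

lemma edge_connectivity_le_degree:
  assumes "pair_graph G" "2 \<le> card (pverts G)" "u \<in> pverts G"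
  shows "edge_connectivity G \<le> card (uedges_at G u)"
proof -
  obtain v where "v \<in> pverts G" "v \<noteq> u"
    using obtain_other_vertex[OF pair_graph_finite_pverts[OF assms(1)] assms(2)] .
  then have "\<not> Digraph_Component.connected (with_proj (delete_uedges G (uedges_at G u)))"
    using not_connected_delete_uedges_at[OF assms(1,3)] by metis
  moreover have "uedges_at G u \<subseteq> uedges G"
    by (auto simp: uedges_at_def)
  moreover have "card (pverts G) \<noteq> 1"
    using assms(2) by linarith
  ultimately show ?thesis
    by (intro edge_connectivity_le_card_cut)
qed

lemma obtain_min_edge_cut:
  assumes "pair_graph G" "2 \<le> card (pverts G)"
  obtains F where "F \<subseteq> uedges G" "card F = edge_connectivity G"
    "\<not> Digraph_Component.connected (with_proj (delete_uedges G F))"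
proof -
  let ?cut = "\<lambda>k. \<exists>F \<subseteq> uedges G. card F = k \<and>
                \<not> Digraph_Component.connected (with_proj (delete_uedges G F))"
  have "pverts G \<noteq> {}"
    using assms(2) by (metis card.empty not_numeral_le_zero)
  then obtain u where u: "u \<in> pverts G"
    by blast
  obtain v where "v \<in> pverts G" "v \<noteq> u"
    using obtain_other_vertex[OF pair_graph_finite_pverts[OF assms(1)] assms(2)] .
  then have "?cut (card (uedges_at G u))"
    using not_connected_delete_uedges_at[OF assms(1) u, of v]
    by (intro exI[of _ "uedges_at G u"]) (auto simp: uedges_at_def)
  then have "?cut (LEAST k. ?cut k)"
    by (rule LeastI)
  moreover have "edge_connectivity G = (LEAST k. ?cut k)"
    using assms(2) by (simp add: edge_connectivity_def)
  ultimately have "?cut (edge_connectivity G)"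
    by simp
  with that show ?thesis by blast
qed

lemma edge_connectivity_geI:
  assumes "pair_graph G" "2 \<le> card (pverts G)"
    and "\<And>F. F \<subseteq> uedges G \<Longrightarrow> card F < m \<Longrightarrow>
           Digraph_Component.connected (with_proj (delete_uedges G F))"
  shows "m \<le> edge_connectivity G"
proof (rule ccontr)
  assume less: "\<not> m \<le> edge_connectivity G"
  obtain F where "F \<subseteq> uedges G" "card F = edge_connectivity G"
    "\<not> Digraph_Component.connected (with_proj (delete_uedges G F))"
    using obtain_min_edge_cut[OF assms(1,2)] .
  with assms(3)[of F] less show False by simp
qed

text \<open>
  A complete graph has to be treated separately, as its vertex connectivity is not defined by
  cuts; but any two of its vertices are adjacent.
\<close>

lemma rtrancl_avoiding_vertex:
  assumes "pair_graph G" "2 \<le> vertex_connectivity G" "x \<in> pverts G"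
    and "u \<in> pverts G - {x}" "v \<in> pverts G - {x}"
  shows "(u, v) \<in> {(a, b) \<in> parcs G. a \<noteq> x \<and> b \<noteq> x}\<^sup>*"
proof (cases "complete_digraph (card (pverts G)) (with_proj G)")
  case True
  then have "parcs G = {(u, v). (u, v) \<in> pverts G \<times> pverts G \<and> u \<noteq> v}"
    by (simp add: complete_digraph_def)
  with assms(4,5) show ?thesis
    by (cases "u = v") (auto intro: r_into_rtrancl)
next
  case False
  let ?G' = "with_proj G \<restriction> (pverts G - {x})"
  interpret pair_graph G by fact
  have arcs: "arcs_ends ?G' = {(a, b) \<in> parcs G. a \<noteq> x \<and> b \<noteq> x}"
    using pair_graphD[OF assms(1)]
    by (auto simp: arcs_ends_conv induce_subgraph_def)
  have "1 < (LEAST k. \<exists>S \<subset> pverts G. card S = k \<and>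
              \<not> Digraph_Component.connected (with_proj G \<restriction> (pverts G - S)))"
    using assms(2) False by (simp add: vertex_connectivity_def)
  from not_less_Least[OF this] have "Digraph_Component.connected ?G'"
    using assms(3,4) by (auto dest: spec[of _ "{x}"])
  moreover have "sym_digraph ?G'"
  proof -
    interpret G': wf_digraph ?G'
      by (rule wf_digraph.wellformed_induce_subgraph) unfold_locales
    show ?thesis
      by unfold_locales
         (use pair_graphD(4)[OF assms(1)] in
           \<open>auto simp: finite_verts finite_arcs symmetric_def arcs sym_def\<close>)
  qed
  ultimately show ?thesis
    using assms(4,5) by (auto simp: sym_digraph.connected_iff_rtrancl arcs)
qed

section \<open>The edges of the replacement product\<close>

locale labelled_graphs =
  fixes G :: "'a pair_pre_digraph" and H :: "'b pair_pre_digraph"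
    and e :: "'a \<Rightarrow> 'b \<Rightarrow> 'a set"
  assumes graph_G: "pair_graph G" and graph_H: "pair_graph H"
    and nonempty_G: "pverts G \<noteq> {}" and nonempty_H: "pverts H \<noteq> {}"
    and labelling: "edge_labelling G H e"
begin

abbreviation P :: "('a \<times> 'b) pair_pre_digraph" where
  "P \<equiv> replacement_product G H e"

lemma pverts_product: "pverts P = pverts G \<times> pverts H"
  by (simp add: replacement_product_def)

lemma label_in_uedges_at:
  "x \<in> pverts G \<Longrightarrow> i \<in> pverts H \<Longrightarrow> e x i \<in> uedges_at G x"
  using labelling by (auto simp: edge_labelling_def bij_betw_def)

lemma label_inj:
  "x \<in> pverts G \<Longrightarrow> i \<in> pverts H \<Longrightarrow> j \<in> pverts H \<Longrightarrow> e x i = e x j \<Longrightarrow> i = j"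
  using labelling by (auto simp: edge_labelling_def bij_betw_def inj_on_def)

lemma obtain_labels:
  assumes "(x, y) \<in> parcs G"
  obtains i j where "i \<in> pverts H" "j \<in> pverts H" "e x i = {x, y}" "e y j = {x, y}"
proof -
  have "{x, y} \<in> e z ` pverts H" if "z \<in> {x, y}" for z
  proof -
    have "z \<in> pverts G" "{x, y} \<in> uedges_at G z"
      using that pair_graphD[OF graph_G assms] assms by (auto simp: uedges_at_def uedges_def)
    then show ?thesis
      using labelling by (auto simp: edge_labelling_def bij_betw_def)
  qed
  from this[of x] this[of y] obtain i j
    where "i \<in> pverts H" "{x, y} = e x i" "j \<in> pverts H" "{x, y} = e y j"
    by auto
  with that show ?thesis by metis
qed

text \<open>
  The ends of the matching edge over an edge \<open>f\<close> of \<open>G\<close> are exactly the vertices \<open>(z, k)\<close> whose label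
  \<open>k\<close> denotes \<open>f\<close> at \<open>z\<close>. This form treats both ends alike, and projecting it to \<open>G\<close> gives back \<open>f\<close>.
\<close>

definition matching_edge :: "'a set \<Rightarrow> ('a \<times> 'b) set" where
  "matching_edge f = {(z, k) \<in> pverts G \<times> pverts H. e z k = f}"

lemma matching_edge_eq:
  assumes "(x, y) \<in> parcs G" "i \<in> pverts H" "j \<in> pverts H" "e x i = {x, y}" "e y j = {x, y}"
  shows "matching_edge {x, y} = {(x, i), (y, j)}"
proof -
  have xy: "x \<in> pverts G" "y \<in> pverts G"
    using pair_graphD[OF graph_G assms(1)] by auto
  have "p \<in> {(x, i), (y, j)}" if p_in: "p \<in> matching_edge {x, y}" for p
  proof -
    obtain z k where p: "p = (z, k)" and zk: "z \<in> pverts G" "k \<in> pverts H" "e z k = {x, y}"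
      using p_in by (auto simp: matching_edge_def)
    then have "z = x \<or> z = y"
      using label_in_uedges_at[OF zk(1,2)] by (auto simp: uedges_at_def)
    then show ?thesis
      using label_inj[OF xy(1) zk(2) assms(2)] label_inj[OF xy(2) zk(2) assms(3)] zk(3) assms(4,5)
      by (auto simp: p)
  qed
  then show ?thesis
    using assms xy by (auto simp: matching_edge_def)
qed

lemma product_arc_cases:
  assumes "((x, i), (y, j)) \<in> parcs P"
  obtains (copy) "x \<in> pverts G" "y = x" "(i, j) \<in> parcs H"
  | (matching) "(x, y) \<in> parcs G" "i \<in> pverts H" "j \<in> pverts H" "e x i = {x, y}" "e y j = {x, y}"
  using assms by (auto simp: replacement_product_def)

lemma copy_arc:
  "x \<in> pverts G \<Longrightarrow> (i, j) \<in> parcs H \<Longrightarrow> ((x, i), (x, j)) \<in> parcs P"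
  using pair_graphD[OF graph_H] by (auto simp: replacement_product_def)

lemma matching_arc:
  assumes "(x, y) \<in> parcs G" "i \<in> pverts H" "j \<in> pverts H" "e x i = {x, y}" "e y j = {x, y}"
  shows "((x, i), (y, j)) \<in> parcs P"
  using assms pair_graphD[OF graph_G assms(1)] by (auto simp: replacement_product_def)

lemma graph_product: "pair_graph P"
proof (rule pair_graphI)
  show "finite (pverts P)"
    using graph_G graph_H by (simp add: pverts_product pair_graph_finite_pverts)
next
  fix p q assume "(p, q) \<in> parcs P"
  then show "p \<in> pverts P \<and> q \<in> pverts P \<and> p \<noteq> q \<and> (q, p) \<in> parcs P"
    using pair_graphD[OF graph_G] pair_graphD[OF graph_H]
    by (auto simp: replacement_product_def insert_commute)
qed

lemma two_le_card_G: "2 \<le> card (pverts G)"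
proof -
  obtain x i where "x \<in> pverts G" "i \<in> pverts H"
    using nonempty_G nonempty_H by auto
  from label_in_uedges_at[OF this] obtain u v where "(u, v) \<in> parcs G"
    by (auto simp: uedges_at_def uedges_def)
  then have "{u, v} \<subseteq> pverts G" "card {u, v} = 2"
    using pair_graphD[OF graph_G] by auto
  then show ?thesis
    using card_mono[OF pair_graph_finite_pverts[OF graph_G]] by metis
qed

lemma two_le_card_product: "2 \<le> card (pverts P)"
proof -
  have "1 \<le> card (pverts H)"
    using nonempty_H pair_graph_finite_pverts[OF graph_H]
    by (simp add: Suc_le_eq card_gt_0_iff)
  with two_le_card_G show ?thesis
    using mult_le_mono[of 2 "card (pverts G)" 1] by (simp add: pverts_product card_cartesian_product)
qed

lemma matching_edge_in_uedges:
  assumes "f \<in> uedges G"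
  shows "matching_edge f \<in> uedges P" "fst ` matching_edge f = f"
proof -
  obtain x y where f: "f = {x, y}" and xy: "(x, y) \<in> parcs G"
    using assms by (auto simp: uedges_def)
  obtain i j where ij: "i \<in> pverts H" "j \<in> pverts H" "e x i = {x, y}" "e y j = {x, y}"
    using obtain_labels[OF xy] .
  show "matching_edge f \<in> uedges P" "fst ` matching_edge f = f"
    using matching_edge_eq[OF xy ij] matching_arc[OF xy ij] f
    by (auto simp: uedges_def)
qed

lemma inj_on_matching_edge: "inj_on matching_edge (uedges G)"
  using matching_edge_in_uedges(2) by (rule inj_on_inverseI)

section \<open>Upper bounds\<close>

text \<open>Contracting the copies maps paths avoiding the lifted cut to paths avoiding the cut.\<close>

lemma lift_edge_cut:
  assumes cut: "\<not> Digraph_Component.connected (with_proj (delete_uedges G F))"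
  shows "\<not> Digraph_Component.connected (with_proj (delete_uedges P (matching_edge ` F)))"
proof
  assume conn: "Digraph_Component.connected (with_proj (delete_uedges P (matching_edge ` F)))"
  let ?R = "parcs (delete_uedges P (matching_edge ` F))"
  let ?S = "parcs (delete_uedges G F)"
  have step: "(fst p, fst q) \<in> ?S\<^sup>*" if "(p, q) \<in> ?R" for p q
  proof -
    obtain x i y j where pq: "p = (x, i)" "q = (y, j)"
      by (cases p, cases q)
    have arc: "((x, i), (y, j)) \<in> parcs P" and nin: "{(x, i), (y, j)} \<notin> matching_edge ` F"
      using that pq by (auto simp: parcs_delete_uedges)
    from arc show ?thesis
    proof (cases rule: product_arc_cases)
      case copy
      then show ?thesis by (simp add: pq)
    next
      case matching
      then have "{x, y} \<notin> F"
        using nin matching_edge_eq[OF matching] by auto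
      with matching(1) show ?thesis
        by (auto simp: pq parcs_delete_uedges)
    qed
  qed
  have "(fst p, fst q) \<in> ?S\<^sup>*" if "(p, q) \<in> ?R\<^sup>*" for p q
    using that by induction (auto dest: step)
  then have contract: "(x, y) \<in> ?S\<^sup>*" if "((x, i), (y, j)) \<in> ?R\<^sup>*" for x y i j
    using that by fastforce
  obtain i where "i \<in> pverts H"
    using nonempty_H by auto
  then have "(u, v) \<in> ?S\<^sup>*" if "u \<in> pverts G" "v \<in> pverts G" for u v
    using conn that
    by (intro contract[of u i v i])
       (simp add: connected_delete_uedges_iff[OF graph_product] pverts_product)
  with cut nonempty_G show False
    by (simp add: connected_delete_uedges_iff[OF graph_G])
qed

lemma edge_connectivity_product_le: "edge_connectivity P \<le> edge_connectivity G"
proof -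
  obtain F where F: "F \<subseteq> uedges G" "card F = edge_connectivity G"
    "\<not> Digraph_Component.connected (with_proj (delete_uedges G F))"
    using obtain_min_edge_cut[OF graph_G two_le_card_G] .
  have "edge_connectivity P \<le> card (matching_edge ` F)"
    using F two_le_card_product matching_edge_in_uedges(1)
    by (intro edge_connectivity_le_card_cut lift_edge_cut) auto
  also have "\<dots> \<le> card F"
    using F(1) finite_uedges[OF graph_G] by (intro card_image_le) (rule finite_subset)
  finally show ?thesis
    using F(2) by simp
qed

lemma card_uedges_at_product:
  assumes "x \<in> pverts G" "i \<in> pverts H"
  shows "card (uedges_at P (x, i)) \<le> card (uedges_at H i) + 1"
proof -
  let ?E = "(`) (Pair x) ` uedges_at H i"
  have fin: "finite (uedges_at H i)"
    using finite_uedges[OF graph_H] by (simp add: uedges_at_def)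
  have "f \<in> insert (matching_edge (e x i)) ?E" if f: "f \<in> uedges_at P (x, i)" for f
  proof -
    obtain q where "((x, i), q) \<in> parcs P" "f = {(x, i), q}"
      using uedges_at_obtain_arc[OF graph_product f] .
    then obtain y j where arc: "((x, i), (y, j)) \<in> parcs P" and f_eq: "f = {(x, i), (y, j)}"
      by (cases q) auto
    from arc show ?thesis
    proof (cases rule: product_arc_cases)
      case copy
      then have "f = Pair x ` {i, j}" "{i, j} \<in> uedges_at H i"
        by (auto simp: f_eq uedges_at_def uedges_def)
      then show ?thesis by blast
    next
      case matching
      then show ?thesis
        using matching_edge_eq by (simp add: f_eq)
    qed
  qed
  then have "card (uedges_at P (x, i)) \<le> card (insert (matching_edge (e x i)) ?E)"
    using fin by (intro card_mono) auto
  also have "\<dots> \<le> card ?E + 1"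
    by (simp add: card_insert_if fin)
  also have "\<dots> \<le> card (uedges_at H i) + 1"
    using card_image_le[OF fin] by simp
  finally show ?thesis .
qed

section \<open>Lower bounds\<close>

definition fibre_edges :: "('a \<times> 'b) set set \<Rightarrow> 'a \<Rightarrow> 'b set set" where
  "fibre_edges F x = {f \<in> uedges H. Pair x ` f \<in> F}"

lemma inj_image_Pair: "inj ((`) (Pair x))"
proof -
  have "inj (Pair x)"
    by (rule injI) simp
  then show ?thesis
    by (intro injI) (rule inj_image_eq_iff[of "Pair x", THEN iffD1])
qed

lemma card_fibre_edges: "card ((`) (Pair x) ` fibre_edges F x) = card (fibre_edges F x)"
  by (intro card_image inj_on_subset[OF inj_image_Pair]) simp

lemma card_fibre_edges_le: "finite F \<Longrightarrow> card (fibre_edges F x) \<le> card F"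
  unfolding card_fibre_edges[symmetric]
  by (intro card_mono) (auto simp: fibre_edges_def)

lemma copy_connected:
  assumes "x \<in> pverts G"
    and "Digraph_Component.connected (with_proj (delete_uedges H (fibre_edges F x)))"
    and "i \<in> pverts H" "j \<in> pverts H"
  shows "((x, i), (x, j)) \<in> (parcs (delete_uedges P F))\<^sup>*"
proof -
  have "(i, j) \<in> (parcs (delete_uedges H (fibre_edges F x)))\<^sup>*"
    using assms by (simp add: connected_delete_uedges_iff[OF graph_H])
  then show ?thesis
  proof induction
    case (step j k)
    then have "((x, j), (x, k)) \<in> parcs (delete_uedges P F)"
      using assms(1) copy_arc
      by (auto simp: parcs_delete_uedges fibre_edges_def uedges_iff[OF graph_H])
    with step.IH show ?case
      by (rule rtrancl_into_rtrancl)
  qed simp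
qed

text \<open>
  A walk of \<open>G\<close> lifts to \<open>P\<close>: inside each copy that it passes, one moves from the end of the arriving
  matching edge to the start of the leaving one. The set \<open>A\<close> of copies that may be passed is a
  parameter in order to be able to avoid a damaged copy.
\<close>

lemma lift_walk:
  assumes "(x, y) \<in> S\<^sup>*" "x \<in> A" "A \<subseteq> pverts G"
    and copies: "\<And>z. z \<in> A \<Longrightarrow>
          Digraph_Component.connected (with_proj (delete_uedges H (fibre_edges F z)))"
    and S: "\<And>u v. (u, v) \<in> S \<Longrightarrow> (u, v) \<in> parcs G \<and> v \<in> A \<and> matching_edge {u, v} \<notin> F"
    and "i \<in> pverts H" "j \<in> pverts H"
  shows "((x, i), (y, j)) \<in> (parcs (delete_uedges P F))\<^sup>*"
proof -
  let ?R = "parcs (delete_uedges P F)"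
  from assms(1) have "\<forall>j\<in>pverts H. ((x, i), (y, j)) \<in> ?R\<^sup>*"
  proof induction
    case base
    then show ?case
      using copy_connected copies assms(2,3,6) by blast
  next
    case (step u v)
    have uv: "(u, v) \<in> parcs G" "v \<in> A" "matching_edge {u, v} \<notin> F"
      using S step.hyps by auto
    obtain k l where kl: "k \<in> pverts H" "l \<in> pverts H" "e u k = {u, v}" "e v l = {u, v}"
      using obtain_labels[OF uv(1)] .
    have "((u, k), (v, l)) \<in> ?R"
      using matching_arc[OF uv(1) kl] matching_edge_eq[OF uv(1) kl] uv(3)
      by (simp add: parcs_delete_uedges)
    with step.IH kl(1) have "((x, i), (v, l)) \<in> ?R\<^sup>*"
      by (meson rtrancl_into_rtrancl)
    then show ?case
      using copy_connected copies uv(2) assms(3) kl(2) by (meson rtrancl_trans subsetD)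
  qed
  with assms(7) show ?thesis by blast
qed

lemma connected_if_copies_connected:
  assumes "F \<subseteq> uedges P" "card F < edge_connectivity G"
    and copies: "\<And>z. z \<in> pverts G \<Longrightarrow> card (fibre_edges F z) < edge_connectivity H"
  shows "Digraph_Component.connected (with_proj (delete_uedges P F))"
proof -
  let ?F' = "{f \<in> uedges G. matching_edge f \<in> F}"
  have fin: "finite F"
    using assms(1) finite_uedges[OF graph_product] by (rule finite_subset)
  have "card ?F' = card (matching_edge ` ?F')"
    by (rule card_image[symmetric]) (rule inj_on_subset[OF inj_on_matching_edge], auto)
  also have "\<dots> \<le> card F"
    using fin by (intro card_mono) auto
  finally have "Digraph_Component.connected (with_proj (delete_uedges G ?F'))"
    using assms(2) by (intro connected_delete_few_uedges) auto
  then have walk: "(x, y) \<in> (parcs (delete_uedges G ?F'))\<^sup>*"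
    if "x \<in> pverts G" "y \<in> pverts G" for x y
    using that by (simp add: connected_delete_uedges_iff[OF graph_G])
  have "((x, i), (y, j)) \<in> (parcs (delete_uedges P F))\<^sup>*"
    if "x \<in> pverts G" "y \<in> pverts G" "i \<in> pverts H" "j \<in> pverts H" for x y i j
  proof (rule lift_walk[OF walk[OF that(1,2)], of "pverts G"])
    fix u v assume "(u, v) \<in> parcs (delete_uedges G ?F')"
    then show "(u, v) \<in> parcs G \<and> v \<in> pverts G \<and> matching_edge {u, v} \<notin> F"
      using pair_graphD[OF graph_G] by (auto simp: parcs_delete_uedges uedges_iff[OF graph_G])
  next
    fix z assume "z \<in> pverts G"
    then show "Digraph_Component.connected (with_proj (delete_uedges H (fibre_edges F z)))"
      using copies by (intro connected_delete_few_uedges) (auto simp: fibre_edges_def)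
  qed (use that in auto)
  then show ?thesis
    using nonempty_G nonempty_H
    by (auto simp: connected_delete_uedges_iff[OF graph_product] pverts_product)
qed

text \<open>
  A matching edge projects to two vertices of \<open>G\<close> and an edge in the copy of \<open>x\<close> to \<open>x\<close> alone, so
  neither the matching edges nor the copies other than that of \<open>x\<close> are affected by \<open>F\<close>.
\<close>

lemma connected_if_cut_in_one_copy:
  assumes "connected (with_proj H)" "2 \<le> vertex_connectivity G" "x \<in> pverts G"
    and F: "\<And>f. f \<in> F \<Longrightarrow> fst ` f = {x}"
  shows "Digraph_Component.connected (with_proj (delete_uedges P F))"
proof -
  let ?R = "parcs (delete_uedges P F)"
  have matching: "matching_edge {u, v} \<notin> F" if "(u, v) \<in> parcs G" for u v
    using F matching_edge_in_uedges(2)[of "{u, v}"] that pair_graphD(3)[OF graph_G that]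
    by (force simp: uedges_iff[OF graph_G])
  have copies: "Digraph_Component.connected (with_proj (delete_uedges H (fibre_edges F z)))"
    if "z \<in> pverts G - {x}" for z
  proof -
    have "fibre_edges F z = {}"
      using F that by (force simp: fibre_edges_def uedges_def)
    then show ?thesis
      using assms(1) by (simp add: delete_uedges_def)
  qed
  have outside: "((y, i), (z, j)) \<in> ?R\<^sup>*"
    if "y \<in> pverts G - {x}" "z \<in> pverts G - {x}" "i \<in> pverts H" "j \<in> pverts H" for y z i j
    by (rule lift_walk[OF rtrancl_avoiding_vertex[OF graph_G assms(2,3) that(1,2)],
          of "pverts G - {x}"])
       (use that copies matching pair_graphD[OF graph_G] in auto)
  have exit: "\<exists>z j. z \<in> pverts G - {x} \<and> j \<in> pverts H \<and> (p, (z, j)) \<in> ?R\<^sup>*"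
    if p: "p \<in> pverts P" for p
  proof -
    obtain y i where yi: "p = (y, i)" "y \<in> pverts G" "i \<in> pverts H"
      using p by (auto simp: pverts_product)
    show ?thesis
    proof (cases "y = x")
      case True
      obtain z where xz: "(x, z) \<in> parcs G" "e x i = {x, z}"
        using uedges_at_obtain_arc[OF graph_G label_in_uedges_at[OF assms(3) yi(3)]] .
      obtain j where j: "j \<in> pverts H" "e z j = {x, z}"
        using obtain_labels[OF xz(1)] .
      have "((x, i), (z, j)) \<in> ?R"
        using matching_arc[OF xz(1) yi(3) j(1) xz(2) j(2)] matching[OF xz(1)]
          matching_edge_eq[OF xz(1) yi(3) j(1) xz(2) j(2)]
        by (simp add: parcs_delete_uedges)
      with j(1) pair_graphD[OF graph_G xz(1)] show ?thesis
        unfolding yi(1) True by blast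
    qed (use yi in blast)
  qed
  have "sym ?R"
    using pair_graphD(4)[OF pair_graph_delete_uedges[OF graph_product]] by (auto simp: sym_def)
  then have "sym (?R\<^sup>*)"
    by (rule sym_rtrancl)
  then have "(p, q) \<in> ?R\<^sup>*" if "p \<in> pverts P" "q \<in> pverts P" for p q
    using exit[OF that(1)] exit[OF that(2)] outside by (meson rtrancl_trans symE)
  then show ?thesis
    using nonempty_G nonempty_H
    by (auto simp: connected_delete_uedges_iff[OF graph_product] pverts_product)
qed

lemma min_edge_connectivity_le_product:
  "min (edge_connectivity G) (edge_connectivity H) \<le> edge_connectivity P"
proof (rule edge_connectivity_geI[OF graph_product two_le_card_product])
  fix F assume F: "F \<subseteq> uedges P" "card F < min (edge_connectivity G) (edge_connectivity H)"
  have "finite F"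
    using F(1) finite_uedges[OF graph_product] by (rule finite_subset)
  then have "card (fibre_edges F z) < edge_connectivity H" for z
    using card_fibre_edges_le F(2) by (metis le_less_trans min_less_iff_conj)
  with F show "Digraph_Component.connected (with_proj (delete_uedges P F))"
    by (intro connected_if_copies_connected) auto
qed

lemma min_edge_connectivity_Suc_le_product:
  assumes "Digraph_Component.connected (with_proj H)" "2 \<le> vertex_connectivity G"
  shows "min (edge_connectivity G) (edge_connectivity H + 1) \<le> edge_connectivity P"
proof (rule edge_connectivity_geI[OF graph_product two_le_card_product])
  fix F assume F: "F \<subseteq> uedges P" "card F < min (edge_connectivity G) (edge_connectivity H + 1)"
  have fin: "finite F"
    using F(1) finite_uedges[OF graph_product] by (rule finite_subset)
  show "Digraph_Component.connected (with_proj (delete_uedges P F))"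
  proof (cases "\<forall>z\<in>pverts G. card (fibre_edges F z) < edge_connectivity H")
    case True
    with F show ?thesis
      by (intro connected_if_copies_connected) auto
  next
    case False
    then obtain x where x: "x \<in> pverts G" "edge_connectivity H \<le> card (fibre_edges F x)"
      by auto
    \<comment> \<open>The copy of \<open>x\<close> contains at least \<open>card F\<close> edges of \<open>F\<close>, hence all of them.\<close>
    have "card F \<le> card ((`) (Pair x) ` fibre_edges F x)"
      using F(2) x(2) by (simp add: card_fibre_edges)
    moreover have "(`) (Pair x) ` fibre_edges F x \<subseteq> F"
      by (auto simp: fibre_edges_def)
    ultimately have F_eq: "(`) (Pair x) ` fibre_edges F x = F"
      using fin by (metis card_seteq)
    have "fst ` f = {x}" if "f \<in> F" for f
    proof -
      have "f \<in> (`) (Pair x) ` fibre_edges F x"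
        using that by (simp only: F_eq)
      then obtain g where g: "f = Pair x ` g" "g \<in> fibre_edges F x"
        by (rule imageE)
      then have "g \<in> uedges H"
        by (simp add: fibre_edges_def)
      with g(1) show ?thesis
        by (auto simp: uedges_def)
    qed
    then show ?thesis
      using connected_if_cut_in_one_copy[OF assms x(1)] by blast
  qed
qed

end

section \<open>Edge connectivity of the replacement product\<close>

theorem theorem3p1:
  fixes G1 :: "'a pair_pre_digraph" and G2 :: "'b pair_pre_digraph"
    and e :: "'a \<Rightarrow> 'b \<Rightarrow> 'a set"
    and n \<delta>1 \<delta>2 :: nat
  assumes "regular_graph \<delta>1 G1" and "Digraph_Component.connected (with_proj G1)"
    and "card (pverts G1) = n"
    and "regular_graph \<delta>2 G2" and "Digraph_Component.connected (with_proj G2)"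
    and "card (pverts G2) = \<delta>1"
    and "edge_labelling G1 G2 e"
  shows "min (edge_connectivity G1) (edge_connectivity G2)
           \<le> edge_connectivity (replacement_product G1 G2 e)
       \<and> edge_connectivity (replacement_product G1 G2 e)
           \<le> min (edge_connectivity G1) (\<delta>2 + 1)
       \<and> (vertex_connectivity G1 \<ge> 2 \<longrightarrow>
            min (edge_connectivity G1) (edge_connectivity G2 + 1)
              \<le> edge_connectivity (replacement_product G1 G2 e))"
proof -
  interpret labelled_graphs G1 G2 e
    using assms by (intro labelled_graphs.intro) (auto simp: regular_graph_def)
  obtain x i where xi: "x \<in> pverts G1" "i \<in> pverts G2"
    using nonempty_G nonempty_H by auto
  have "edge_connectivity P \<le> card (uedges_at P (x, i))"
    using xi by (intro edge_connectivity_le_degree[OF graph_product two_le_card_product])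
      (simp add: pverts_product)
  also have "\<dots> \<le> \<delta>2 + 1"
    using card_uedges_at_product[OF xi] assms(4) xi(2) by (simp add: regular_graph_def)
  finally show ?thesis
    using min_edge_connectivity_le_product edge_connectivity_product_le
      min_edge_connectivity_Suc_le_product[OF assms(5)]
    by simp
qed

end
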